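(* Let $r\ge 1$ be an integer and let $s\in\{1,\dots,r\}$. Then for each integer $n\ge s$, $$D_r(n)=\sum_{j=s}^{n}\binom{j-1}{s-1}\frac{n!}{(n-j)!}D_{r-s}(n-j).$$ In particular, for each $n\ge r$, $$D_r(n)=\sum_{j=r}^{n}\binom{j-1}{r-1}\frac{n!}{(n-j)!}D(n-j).$$ Additionally, for each $n\ge r$, $$D_r(n)=\sum_{j=r}^{n}\binom{j}{r}\frac{n!}{(n-j)!}(-1)^{n-j}.$$
   Context: For integers $n,r\ge 0$, the $r$-derangement number $D_r(n)$ is the number of permutations of $\{1,\dots,n+r\}$ that have no fixed points and in whose cycle decomposition the elements $1,\dots,r$ lie in pairwise distinct cycles. $D(n)=D_0(n)$ is the classical derangement number, i.e. the number of fixed-point-free permutations of $n$ elements (with $D(0)=1$). One has $D_r(n)=0$ if $n<r$. *)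

theory Defs
  imports Complex_Main "HOL-Combinatorics.Combinatorics"
begin

text \<open>
  Since \<open>orbit p a\<close> is the set of entries of the cycle of the permutation \<open>p\<close> that contains \<open>a\<close>,
  two elements lie in distinct cycles iff their orbits differ.
\<close>

definition r_derangements :: "nat \<Rightarrow> nat \<Rightarrow> (nat \<Rightarrow> nat) set" where
  "r_derangements r n =
     {p. p permutes {1..n + r} \<and>
         (\<forall>i\<in>{1..n + r}. p i \<noteq> i) \<and>
         (\<forall>a\<in>{1..r}. \<forall>b\<in>{1..r}. a \<noteq> b \<longrightarrow> orbit p a \<noteq> orbit p b)}"

definition r_derangement_number :: "nat \<Rightarrow> nat \<Rightarrow> nat" where
  "r_derangement_number r n = card (r_derangements r n)"

definition derangement_number :: "nat \<Rightarrow> nat" where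
  "derangement_number n = card {p. p permutes {1..n} \<and> (\<forall>i\<in>{1..n}. p i \<noteq> i)}"

lemma derangement_number_eq: "derangement_number n = r_derangement_number 0 n"
  by (simp add: derangement_number_def r_derangement_number_def r_derangements_def)

lemma derangement_number_0: "derangement_number 0 = 1"
  by (simp add: derangement_number_def)

lemma r_derangement_number_eq_0:
  assumes "n < r"
  shows "r_derangement_number r n = 0"
proof -
  have False if p: "p \<in> r_derangements r n" for p
  proof -
    have perm: "p permutes {1..n + r}" and nofix: "\<forall>i\<in>{1..n + r}. p i \<noteq> i"
      and sep: "\<forall>a\<in>{1..r}. \<forall>b\<in>{1..r}. a \<noteq> b \<longrightarrow> orbit p a \<noteq> orbit p b"
      using p by (auto simp: r_derangements_def)
    have "p a \<in> {r<..n + r}" if a: "a \<in> {1..r}" for a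
    proof -
      have "permutation p"
        using perm by (intro permutes_imp_permutation[of "{1..n + r}"]) simp
      then have "orbit p (p a) = orbit p a"
        by (rule permutation_orbit_step)
      moreover have "p a \<noteq> a"
        using nofix a by simp
      ultimately have "p a \<notin> {1..r}"
        using sep a by blast
      moreover have "p a \<in> {1..n + r}"
        using permutes_in_image[OF perm, of a] a by simp
      ultimately show ?thesis by simp
    qed
    then have "p ` {1..r} \<subseteq> {r<..n + r}" by blast
    then have "card {1..r} \<le> card {r<..n + r}"
      by (intro card_inj_on_le[of p]) (auto intro: permutes_inj_on[OF perm])
    with assms show False by simp
  qed
  then have "r_derangements r n = {}" by blast
  then show ?thesis by (simp add: r_derangement_number_def)
qed

end

theory Submission
  imports Defs
begin

text \<open>
  Write \<open>D r n\<close> for the number of \<open>r\<close>-derangements. Cutting the image of a distinguished element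
  \<open>a\<close> out of its cycle leaves either a derangement in which \<open>a\<close> is still distinguished, or one
  with \<open>a\<close> as an additional fixed point, which can be dropped; hence
  \<open>D r n = n * (D (r - 1) (n - 1) + D r (n - 1))\<close> for \<open>r \<ge> 1\<close>. Together with \<open>D 0 (n + 1) = D 1 n\<close>
  this gives the alternating sum by induction, and in terms of \<open>D r n / n!\<close> the recurrence is that
  of Pascal's triangle, which iterates to the other two formulas.
\<close>

section \<open>Derangements with separated elements of finite sets\<close>

text \<open>Arbitrary sets instead of intervals, because cutting removes an arbitrary
  \<open>x\<close> from \<open>N\<close> and the induction moves elements between \<open>N\<close>
  and \<open>S\<close>; \<open>S\<close> holds the separated elements.\<close>

definition sep_derangements :: "'a set \<Rightarrow> 'a set \<Rightarrow> ('a \<Rightarrow> 'a) set" where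
  "sep_derangements S N =
     {p. p permutes S \<union> N \<and> (\<forall>i\<in>S \<union> N. p i \<noteq> i) \<and>
         (\<forall>a\<in>S. \<forall>b\<in>S. a \<noteq> b \<longrightarrow> orbit p a \<noteq> orbit p b)}"

lemma finite_sep_derangements:
  assumes "finite S" "finite N"
  shows "finite (sep_derangements S N)"
  by (rule finite_subset[OF _ finite_permutations[of "S \<union> N"]])
     (use assms in \<open>auto simp: sep_derangements_def\<close>)

lemma r_derangements_eq_sep_derangements:
  "r_derangements r n = sep_derangements {1..r} {r<..n + r}"
proof -
  have "{1..r} \<union> {r<..n + r} = {1..n + r}" by auto
  then show ?thesis by (simp add: r_derangements_def sep_derangements_def)
qed

section \<open>Cutting an element out of a cycle\<close>

lemma orbit_eq_iff_mem:
  assumes "permutation p"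
  shows "orbit p b = orbit p c \<longleftrightarrow> c \<in> orbit p b"
  using permutation_self_in_orbit[OF assms, of c] orbit_cyclic_eq3[OF cyclic_on_orbit'[OF assms]]
  by blast

text \<open>If \<open>p a = x\<close>, then \<open>p \<circ> transpose a x\<close> is \<open>p\<close> with \<open>x\<close> cut out of its cycle and
  made a fixed point.\<close>

lemma orbit_comp_transpose:
  assumes "inj p" "p a = x" "a \<noteq> x" "b \<noteq> x" "c \<noteq> x"
  shows "c \<in> orbit (p \<circ> transpose a x) b \<longleftrightarrow> c \<in> orbit p b"
proof
  let ?q = "p \<circ> transpose a x"
  have qx: "?q x = x" and qa: "?q a = p x" using assms by auto
  have other: "?q z = p z" if "z \<noteq> a" "z \<noteq> x" for z
    using that by (simp add: transpose_apply_other)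
  have inj: "p z = x \<longleftrightarrow> z = a" for z
    using assms by (metis injD)
  {
    assume "c \<in> orbit ?q b"
    \<comment> \<open>The step of \<open>?q\<close> from \<open>a\<close> is two steps of
      \<open>p\<close>, through \<open>x\<close>.\<close>
    then show "c \<in> orbit p b"
    proof (induction rule: orbit.induct)
      case base
      show ?case
        using other[of b] qa assms by (cases "b = a") (metis orbit.base orbit.step)+
    next
      case (step z)
      then show ?case
        using other[of z] qa qx assms by (metis orbit.step)
    qed
  }
  {
    assume "c \<in> orbit p b"
    \<comment> \<open>The orbit under \<open>p\<close> may pass through \<open>x\<close>, which
      \<open>?q\<close> skips; there the invariant records the next element
      \<open>p x = ?q a\<close> instead.\<close>
    then have "if c = x then ?q a \<in> orbit ?q b else c \<in> orbit ?q b"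
    proof (induction rule: orbit.induct)
      case base
      show ?case
        using other[of b] inj[of b] assms by (metis orbit.base)
    next
      case (step z)
      then show ?case
        using other[of z] inj[of z] qa by (metis orbit.step)
    qed
    then show "c \<in> orbit ?q b" using assms by simp
  }
qed

text \<open>Away from \<open>x\<close> the cut preserves the relation of lying in a common cycle. If
  the cycle of \<open>a\<close> in \<open>p\<close> is just \<open>(a x)\<close>, the cut leaves
  \<open>a\<close> fixed and it drops out (second set); otherwise \<open>a\<close> stays separated
  (first set).\<close>

lemma sep_derangements_cut:
  assumes fin: "finite S" "finite N" and a: "a \<notin> S" "a \<notin> N" and disj: "S \<inter> N = {}"
    and x: "x \<in> N" and perm: "p permutes insert a S \<union> N" and pa: "p a = x"
  shows "p \<in> sep_derangements (insert a S) N \<longleftrightarrow>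
         p \<circ> transpose a x \<in> sep_derangements (insert a S) (N - {x}) \<union> sep_derangements S (N - {x})"
proof -
  let ?q = "p \<circ> transpose a x"
  have ax: "a \<noteq> x" and xS: "x \<notin> S" using a x disj by auto
  have inj: "inj p" using perm by (rule permutes_inj)
  have qx: "?q x = x" using pa by simp
  have other: "?q z = p z" if "z \<noteq> a" "z \<noteq> x" for z
    using that by (simp add: transpose_apply_other)
  have permq0: "?q permutes insert a S \<union> N"
    by (rule permutes_compose[OF permutes_swap_id perm]) (use x in auto)
  have permq: "?q permutes insert a S \<union> (N - {x})"
    by (rule permutes_superset[OF permq0]) (use qx in auto)
  have pp: "permutation p" "permutation ?q"
    using permutes_imp_permutation[OF _ perm] permutes_imp_permutation[OF _ permq0] fin by auto
  have px: "p x \<noteq> x" using inj pa ax by (metis injD)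
  \<comment> \<open>\<open>p\<close> moves \<open>a\<close> and \<open>x\<close> in any case, so
    only the other points matter.\<close>
  have fixed: "(\<forall>i\<in>insert a S \<union> N. p i \<noteq> i) \<longleftrightarrow> (\<forall>i\<in>S \<union> (N - {x}). ?q i \<noteq> i)"
    using a x xS other pa px ax by (metis Diff_iff Un_iff insert_iff singletonD)
  have orb: "orbit p b \<noteq> orbit p c \<longleftrightarrow> orbit ?q b \<noteq> orbit ?q c"
    if "b \<in> insert a S" "c \<in> insert a S" for b c
  proof -
    have "b \<noteq> x" "c \<noteq> x" using that ax xS by auto
    then show ?thesis
      using orbit_comp_transpose[OF inj pa ax] orbit_eq_iff_mem pp by metis
  qed
  have lhs: "p \<in> sep_derangements (insert a S) N \<longleftrightarrow>
      (\<forall>i\<in>S \<union> (N - {x}). ?q i \<noteq> i) \<and>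
      (\<forall>b\<in>insert a S. \<forall>c\<in>insert a S. b \<noteq> c \<longrightarrow> orbit ?q b \<noteq> orbit ?q c)"
    unfolding sep_derangements_def mem_Collect_eq fixed using perm orb by blast
  show ?thesis
  proof (cases "?q a = a")
    case True
    have "?q permutes S \<union> (N - {x})"
      by (rule permutes_superset[OF permq]) (use True in auto)
    \<comment> \<open>The orbit of a fixed point is a singleton, so keeping \<open>a\<close> apart
      from \<open>S\<close> is automatic.\<close>
    moreover have "orbit ?q b \<noteq> orbit ?q a \<and> orbit ?q a \<noteq> orbit ?q b" if "b \<in> S" for b
    proof -
      have "orbit ?q a = {a}" using True orbit_eq_singleton_iff by metis
      moreover have "b \<in> orbit ?q b" using pp by (intro permutation_self_in_orbit)
      ultimately show ?thesis using that a by auto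
    qed
    moreover have "?q \<notin> sep_derangements (insert a S) (N - {x})"
      using True by (auto simp: sep_derangements_def)
    ultimately show ?thesis unfolding lhs by (auto simp: sep_derangements_def simp del: o_apply)
  next
    case False
    have "\<not> ?q permutes S \<union> (N - {x})"
      using False a permutes_not_in[of ?q "S \<union> (N - {x})" a] by auto
    then have "?q \<notin> sep_derangements S (N - {x})"
      by (simp add: sep_derangements_def)
    then show ?thesis
      unfolding lhs using False permq by (auto simp: sep_derangements_def simp del: o_apply)
  qed
qed

text \<open>Composing with \<open>transpose a x\<close> is an involution and maps the fibre
  bijectively onto the union of the two sets. These are disjoint: members of the first move
  \<open>a\<close>, members of the second fix it.\<close>

lemma card_sep_derangements_fiber:
  assumes fin: "finite S" "finite N" and a: "a \<notin> S" "a \<notin> N" and disj: "S \<inter> N = {}"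
    and x: "x \<in> N"
  shows "card {p \<in> sep_derangements (insert a S) N. p a = x} =
         card (sep_derangements (insert a S) (N - {x})) + card (sep_derangements S (N - {x}))"
proof -
  let ?A = "sep_derangements (insert a S) (N - {x})" and ?B = "sep_derangements S (N - {x})"
  let ?t = "\<lambda>p. p \<circ> transpose a x"
  have tt: "?t (?t p) = p" for p by (simp add: o_assoc[symmetric])
  have cut: "p \<in> sep_derangements (insert a S) N \<longleftrightarrow> ?t p \<in> ?A \<union> ?B"
    if "p permutes insert a S \<union> N" "p a = x" for p
    by (rule sep_derangements_cut) (use assms that in auto)
  have perm: "?t q permutes insert a S \<union> N \<and> ?t q a = x" if q: "q \<in> ?A \<union> ?B" for q
  proof -
    have "x \<notin> insert a S \<union> (N - {x})" "x \<notin> S \<union> (N - {x})" using a x disj by auto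
    then have "q x = x"
      using q permutes_not_in by (fastforce simp: sep_derangements_def)
    moreover have "q permutes insert a S \<union> N"
      using q by (auto simp: sep_derangements_def elim!: permutes_subset)
    then have "?t q permutes insert a S \<union> N"
      by (intro permutes_compose permutes_swap_id) (use x in auto)
    ultimately show ?thesis by simp
  qed
  have "bij_betw ?t {p \<in> sep_derangements (insert a S) N. p a = x} (?A \<union> ?B)"
  proof (rule bij_betw_byWitness[where f' = ?t])
    show "?t ` {p \<in> sep_derangements (insert a S) N. p a = x} \<subseteq> ?A \<union> ?B"
    proof (intro image_subsetI)
      fix p assume p: "p \<in> {p \<in> sep_derangements (insert a S) N. p a = x}"
      then have "p permutes insert a S \<union> N" by (simp add: sep_derangements_def)
      then show "?t p \<in> ?A \<union> ?B" using cut[of p] p by blast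
    qed
    show "?t ` (?A \<union> ?B) \<subseteq> {p \<in> sep_derangements (insert a S) N. p a = x}"
    proof
      fix p assume "p \<in> ?t ` (?A \<union> ?B)"
      then obtain q where q: "q \<in> ?A \<union> ?B" and p: "p = ?t q" by blast
      have "?t p \<in> ?A \<union> ?B" using q p tt by metis
      then show "p \<in> {p \<in> sep_derangements (insert a S) N. p a = x}"
        using perm[OF q] cut[of p] p by blast
    qed
  qed (use tt in auto)
  moreover have "?A \<inter> ?B = {}"
  proof -
    have "q a = a" if "q \<in> ?B" for q
      using that a permutes_not_in[of q "S \<union> (N - {x})" a] by (auto simp: sep_derangements_def)
    then show ?thesis by (auto simp: sep_derangements_def)
  qed
  ultimately show ?thesis
    using fin by (simp add: bij_betw_same_card card_Un_disjoint finite_sep_derangements)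
qed

text \<open>\<open>p a\<close> lies in the cycle of \<open>a\<close> and differs from
  \<open>a\<close>, so separation forces it into \<open>N\<close>, and the fibres over
  \<open>N\<close> partition the set.\<close>

lemma card_sep_derangements_insert:
  assumes fin: "finite S" "finite N" and a: "a \<notin> S" "a \<notin> N" and disj: "S \<inter> N = {}"
  shows "card (sep_derangements (insert a S) N) =
         (\<Sum>x\<in>N. card (sep_derangements (insert a S) (N - {x})) + card (sep_derangements S (N - {x})))"
proof -
  let ?D = "sep_derangements (insert a S) N"
  have "p a \<in> N" if p: "p \<in> ?D" for p
  proof -
    have perm: "p permutes insert a S \<union> N" and ne: "p a \<noteq> a"
      and sep: "\<forall>b\<in>insert a S. \<forall>c\<in>insert a S. b \<noteq> c \<longrightarrow> orbit p b \<noteq> orbit p c"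
      using p by (auto simp: sep_derangements_def)
    have "permutation p" using permutes_imp_permutation[OF _ perm] fin by auto
    then have "orbit p (p a) = orbit p a" by (rule permutation_orbit_step)
    then have "p a \<notin> insert a S" using sep ne by blast
    moreover have "p a \<in> insert a S \<union> N" using permutes_in_image[OF perm, of a] by simp
    ultimately show ?thesis by blast
  qed
  then have "?D = (\<Union>x\<in>N. {p \<in> ?D. p a = x})" by blast
  then have "card ?D = card (\<Union>x\<in>N. {p \<in> ?D. p a = x})" by simp
  also have "\<dots> = (\<Sum>x\<in>N. card {p \<in> ?D. p a = x})"
    using fin by (intro card_UN_disjoint) (auto simp: finite_sep_derangements)
  also have "\<dots> = (\<Sum>x\<in>N. card (sep_derangements (insert a S) (N - {x}))
                        + card (sep_derangements S (N - {x})))"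
    using assms by (intro sum.cong refl card_sep_derangements_fiber)
  finally show ?thesis .
qed

section \<open>The generating function coefficients and their recurrences\<close>

text \<open>The coefficient of \<open>x ^ n\<close> in \<open>x ^ r * exp (- x) / (1 - x) ^ (r + 1)\<close>.\<close>

definition derange_coeff :: "nat \<Rightarrow> nat \<Rightarrow> real" where
  "derange_coeff r n = (\<Sum>j\<le>n. real (j choose r) * (-1) ^ (n - j) / fact (n - j))"

lemma derange_coeff_0_0: "derange_coeff 0 0 = 1"
  by (simp add: derange_coeff_def)

lemma derange_coeff_Suc_0: "derange_coeff (Suc r) 0 = 0"
  by (simp add: derange_coeff_def)

text \<open>Pascal's rule termwise: passing from \<open>r\<close> to \<open>Suc r\<close> multiplies
  the generating function by \<open>x / (1 - x)\<close>.\<close>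

lemma derange_coeff_Suc_Suc:
  "derange_coeff (Suc r) (Suc n) = derange_coeff r n + derange_coeff (Suc r) n"
  unfolding derange_coeff_def
  by (subst sum.atMost_Suc_shift) (simp add: distrib_right add_divide_distrib sum.distrib)

text \<open>Counterpart of \<open>D 0 (n + 1) = D 1 n\<close>: the derivative of
  \<open>exp (- x) / (1 - x)\<close> is \<open>x * exp (- x) / (1 - x) ^ 2\<close>.\<close>

lemma derange_coeff_0_Suc:
  "real (Suc n) * derange_coeff 0 (Suc n) = derange_coeff (Suc 0) n"
proof -
  let ?e = "\<lambda>k. (-1) ^ k / fact k :: real"
  have flip: "(\<Sum>j\<le>m. f j (m - j)) = (\<Sum>k\<le>m. f (m - k) k)" for m and f :: "nat \<Rightarrow> nat \<Rightarrow> real"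
    by (rule sum.reindex_bij_witness[where i = "\<lambda>k. m - k" and j = "\<lambda>k. m - k"]) auto
  have e_Suc: "?e m = - real (Suc m) * ?e (Suc m)" for m
    by (simp add: fact_Suc del: of_nat_Suc)
  \<comment> \<open>For \<open>k > 0\<close> the summand is \<open>?e k - ?e (k - 1)\<close>, since
    \<open>k * ?e k = - ?e (k - 1)\<close>.\<close>
  have tele: "(\<Sum>k\<le>n. (real k + 1) * ?e k) = ?e n" for n
  proof (induction n)
    case (Suc n)
    have "(real (Suc n) + 1) * ?e (Suc n) + ?e n = ?e (Suc n)"
      unfolding e_Suc[of n] by (simp only: distrib_right mult_minus_left mult_1_left)
    then show ?case using Suc by simp
  qed simp
  have "derange_coeff (Suc 0) n = (\<Sum>k\<le>n. real (n - k) * ?e k)"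
    using flip[where m = n and f = "\<lambda>j k. real j * ?e k"] by (simp add: derange_coeff_def)
  \<comment> \<open>\<open>n - k\<close> is split as \<open>(n + 1) - (k + 1)\<close>, so that the
    second part telescopes.\<close>
  also have "\<dots> = (\<Sum>k\<le>n. real (Suc n) * ?e k - (real k + 1) * ?e k)"
    by (intro sum.cong refl) (simp add: of_nat_diff algebra_simps flip: diff_divide_distrib add_divide_distrib)
  also have "\<dots> = real (Suc n) * (\<Sum>k\<le>n. ?e k) - ?e n"
    unfolding sum_subtractf tele by (simp only: sum_distrib_left)
  \<comment> \<open>\<open>- ?e n\<close> is \<open>Suc n\<close> times the missing term
    \<open>?e (Suc n)\<close>.\<close>
  also have "\<dots> = real (Suc n) * (\<Sum>k\<le>Suc n. ?e k)"
    unfolding e_Suc[of n] by (simp only: sum.atMost_Suc distrib_left mult_minus_left diff_minus_eq_add)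
  also have "(\<Sum>k\<le>Suc n. ?e k) = derange_coeff 0 (Suc n)"
    using flip[where m = "Suc n" and f = "\<lambda>j k. ?e k"] unfolding derange_coeff_def by simp
  finally show ?thesis by simp
qed

section \<open>Counting by induction on the total size\<close>

lemma card_sep_derangements:
  fixes S N :: "'a set"
  assumes "finite S" "finite N" "S \<inter> N = {}"
  shows "real (card (sep_derangements S N)) = fact (card N) * derange_coeff (card S) (card N)"
  using assms
proof (induction "card S + card N" arbitrary: S N rule: less_induct)
  case less
  \<comment> \<open>Only the total size is tied to \<open>S\<close> and \<open>N\<close>, so that
    this also serves the case \<open>S = {}\<close>, where an element of \<open>N\<close> is
    redeclared as separated without changing the total.\<close>
  have step: "real (card (sep_derangements (insert a S') N')) =
      fact (card N') * derange_coeff (Suc (card S')) (card N')"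
    if fin': "finite S'" "finite N'" and a: "a \<notin> S'" "a \<notin> N'" and disj: "S' \<inter> N' = {}"
      and card: "Suc (card S' + card N') = card S + card N" for a and S' N' :: "'a set"
  proof (cases "card N'")
    case 0
    then have "N' = {}" using fin' by simp
    then show ?thesis
      using card_sep_derangements_insert[OF fin' a disj] by (simp add: derange_coeff_Suc_0)
  next
    case (Suc m)
    have "real (card (sep_derangements (insert a S') (N' - {x}))
               + card (sep_derangements S' (N' - {x}))) =
          fact m * derange_coeff (Suc (card S')) (Suc m)" if x: "x \<in> N'" for x
    proof -
      have m: "card (N' - {x}) = m" using Suc x fin' by simp
      have "real (card (sep_derangements (insert a S') (N' - {x}))) =
            fact m * derange_coeff (Suc (card S')) m"
        using less.hyps[of "insert a S'" "N' - {x}"] m fin' a disj card Suc by auto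
      moreover have "real (card (sep_derangements S' (N' - {x}))) =
            fact m * derange_coeff (card S') m"
        using less.hyps[of S' "N' - {x}"] m fin' a disj card Suc by auto
      ultimately show ?thesis
        by (simp add: derange_coeff_Suc_Suc algebra_simps)
    qed
    then have "real (card (sep_derangements (insert a S') N')) =
        real (card N') * (fact m * derange_coeff (Suc (card S')) (Suc m))"
      unfolding card_sep_derangements_insert[OF fin' a disj] of_nat_sum by simp
    then show ?thesis using Suc by simp
  qed
  show ?case
  proof (cases "S = {}")
    case False
    then obtain a S' where S: "S = insert a S'" "a \<notin> S'" by (meson ex_in_conv mk_disjoint_insert)
    then show ?thesis using step[of S' N a] less.prems by auto
  next
    case True
    show ?thesis
    proof (cases "N = {}")
      case True
      have "sep_derangements {} {} = {id :: 'a \<Rightarrow> 'a}" by (auto simp: sep_derangements_def)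
      then show ?thesis using True \<open>S = {}\<close> by (simp add: derange_coeff_0_0)
    next
      case False
      then obtain a N' where N: "N = insert a N'" "a \<notin> N'" by (meson ex_in_conv mk_disjoint_insert)
      then have fin': "finite N'" using less.prems by simp
      \<comment> \<open>Separating a single element is no condition.\<close>
      have "sep_derangements S N = sep_derangements (insert a {}) N'"
        using True N by (simp add: sep_derangements_def)
      also have "real (card \<dots>) = fact (card N') * derange_coeff (Suc 0) (card N')"
        using step[of "{}" N' a] N fin' True by simp
      also have "\<dots> = fact (card N) * derange_coeff (card S) (card N)"
        using N fin' True derange_coeff_0_Suc[of "card N'", symmetric] by simp
      finally show ?thesis .
    qed
  qed
qed

lemma r_derangement_number_eq:
  "real (r_derangement_number r n) = fact n * derange_coeff r n"
  unfolding r_derangement_number_def r_derangements_eq_sep_derangements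
  by (subst card_sep_derangements) auto

section \<open>Iterating the recurrence\<close>

text \<open>Convolution with \<open>(x / (1 - x)) ^ Suc t\<close>, whose coefficient at
  \<open>x ^ Suc i\<close> is \<open>i choose t\<close>. In the induction on \<open>n\<close>,
  \<open>t\<close> varies because Pascal's rule lowers it.\<close>

lemma derange_coeff_add:
  "derange_coeff (q + Suc t) n = (\<Sum>i<n. real (i choose t) * derange_coeff q (n - 1 - i))"
proof (induction n arbitrary: t)
  case 0
  then show ?case by (simp add: derange_coeff_Suc_0)
next
  case (Suc n)
  show ?case
  proof (cases t)
    case 0
    then show ?thesis
      using Suc[of 0] by (subst sum.lessThan_Suc_shift) (simp add: derange_coeff_Suc_Suc)
  next
    case (Suc u)
    then show ?thesis
      using Suc.IH[of t] Suc.IH[of u]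
      by (subst sum.lessThan_Suc_shift)
         (simp add: derange_coeff_Suc_Suc distrib_right sum.distrib)
  qed
qed

lemma r_derangement_number_sum:
  assumes "s \<in> {1..r}"
  shows "real (r_derangement_number r n) =
    (\<Sum>j=s..n. real ((j - 1) choose (s - 1)) * (fact n / fact (n - j))
                * real (r_derangement_number (r - s) (n - j)))"
proof -
  have "derange_coeff r n =
      (\<Sum>i<n. real (i choose (s - 1)) * derange_coeff (r - s) (n - 1 - i))"
    using derange_coeff_add[of "r - s" "s - 1" n] assms by simp
  also have "\<dots> = (\<Sum>j=1..n. real ((j - 1) choose (s - 1)) * derange_coeff (r - s) (n - j))"
    by (rule sum.reindex_bij_witness[where i = "\<lambda>j. j - 1" and j = Suc]) auto
  \<comment> \<open>Terms with \<open>1 \<le> j < s\<close> vanish, since then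
    \<open>j - 1 < s - 1\<close>.\<close>
  also have "\<dots> = (\<Sum>j=s..n. real ((j - 1) choose (s - 1)) * derange_coeff (r - s) (n - j))"
    using assms by (intro sum.mono_neutral_right) auto
  finally show ?thesis
    by (simp add: r_derangement_number_eq sum_distrib_left mult_ac)
qed

lemma r_derangement_number_alternating_sum:
  "real (r_derangement_number r n) =
    (\<Sum>j=r..n. real (j choose r) * (fact n / fact (n - j)) * (-1) ^ (n - j))"
proof -
  have "derange_coeff r n = (\<Sum>j=r..n. real (j choose r) * (-1) ^ (n - j) / fact (n - j))"
    unfolding derange_coeff_def by (intro sum.mono_neutral_right) (auto simp: not_le)
  then show ?thesis
    by (simp add: r_derangement_number_eq sum_distrib_left mult_ac)
qed

theorem theorem4:
  fixes r :: nat
  assumes "r \<ge> 1"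
  shows "(\<forall>s\<in>{1..r}. \<forall>n\<ge>s.
            real (r_derangement_number r n) =
              (\<Sum>j=s..n. real ((j - 1) choose (s - 1)) * (fact n / fact (n - j))
                          * real (r_derangement_number (r - s) (n - j))))
       \<and> (\<forall>n\<ge>r.
            real (r_derangement_number r n) =
              (\<Sum>j=r..n. real ((j - 1) choose (r - 1)) * (fact n / fact (n - j))
                          * real (derangement_number (n - j))))
       \<and> (\<forall>n\<ge>r.
            real (r_derangement_number r n) =
              (\<Sum>j=r..n. real (j choose r) * (fact n / fact (n - j)) * (-1) ^ (n - j)))"
proof (intro conjI ballI allI impI)
  \<comment> \<open>The case \<open>s = r\<close> of the first formula, where
    \<open>r - s = 0\<close> gives the classical numbers.\<close>
  fix n
  show "real (r_derangement_number r n) =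
      (\<Sum>j=r..n. real ((j - 1) choose (r - 1)) * (fact n / fact (n - j))
                  * real (derangement_number (n - j)))"
    using r_derangement_number_sum[of r r n] assms by (simp add: derangement_number_eq)
qed (rule r_derangement_number_sum r_derangement_number_alternating_sum, assumption?)+

end
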